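(* Let $\mathbb{X}$ be a real Banach space and let $\mathbb{Y}$ be a smooth real Banach space. Let $T\in S_{\mathbb{L}(\mathbb{X},\mathbb{Y})}$ be such that $M_T\neq\emptyset$. Suppose that for each $\epsilon>0$, $T$ admits a non-trivial uniform $\epsilon$-BPB approximation which is smooth. Then $T$ is smooth.
   Context: $\mathbb{L}(\mathbb{X},\mathbb{Y})$ is the space of bounded linear operators with the operator norm; $S_Z$ is the unit sphere of a normed space $Z$. A non-zero element $z$ of a normed space $Z$ is smooth if there is exactly one $f\in S_{Z^*}$ with $f(z)=\|z\|$; a Banach space is smooth if each of its non-zero vectors is smooth. An operator is called smooth if it is a smooth element of the normed space $\mathbb{L}(\mathbb{X},\mathbb{Y})$. For $A\in\mathbb{L}(\mathbb{X},\mathbb{Y})$, $M_A=\{x\in S_{\mathbb{X}}:\|Ax\|=\|A\|\}$. For $T\in S_{\mathbb{L}(\mathbb{X},\mathbb{Y})}$ and $\epsilon>0$, an operator $A\in S_{\mathbb{L}(\mathbb{X},\mathbb{Y})}$ is a uniform $\epsilon$-BPB approximation of $T$ if $\|T-A\|<\epsilon$ and there exists $\delta(\epsilon)>0$ such that for each $x_0\in S_{\mathbb{X}}$ with $\|Tx_0\|>1-\delta(\epsilon)$ there exists $u_0\in M_A$ with $\|u_0-x_0\|<\epsilon$. It is non-trivial if in addition $A\neq T$. *)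

theory Defs
  imports "HOL-Analysis.Analysis"
begin

text \<open>The dual of a normed space \<open>'z\<close> is the type \<open>'z \<Rightarrow>\<^sub>L real\<close> of bounded linear
  functionals; its norm, like that of \<open>'a \<Rightarrow>\<^sub>L 'b\<close>, is the operator norm.\<close>

definition smooth_element :: "'z::real_normed_vector \<Rightarrow> bool" where
  "smooth_element z \<longleftrightarrow>
     z \<noteq> 0 \<and> (\<exists>!f :: 'z \<Rightarrow>\<^sub>L real. f \<in> sphere 0 1 \<and> blinfun_apply f z = norm z)"

definition smooth_space :: "'z::real_normed_vector itself \<Rightarrow> bool" where
  "smooth_space _ \<longleftrightarrow> (\<forall>z::'z. z \<noteq> 0 \<longrightarrow> smooth_element z)"

definition norm_attainment_set ::
    "('a::real_normed_vector \<Rightarrow>\<^sub>L 'b::real_normed_vector) \<Rightarrow> 'a set" where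
  "norm_attainment_set A = {x \<in> sphere 0 1. norm (blinfun_apply A x) = norm A}"

definition uniform_BPB_approx ::
    "real \<Rightarrow> ('a::real_normed_vector \<Rightarrow>\<^sub>L 'b::real_normed_vector) \<Rightarrow> ('a \<Rightarrow>\<^sub>L 'b) \<Rightarrow> bool" where
  "uniform_BPB_approx \<epsilon> T A \<longleftrightarrow>
     \<epsilon> > 0 \<and> T \<in> sphere 0 1 \<and> A \<in> sphere 0 1 \<and> norm (T - A) < \<epsilon> \<and>
     (\<exists>\<delta>>0. \<forall>x\<^sub>0\<in>sphere 0 1. norm (blinfun_apply T x\<^sub>0) > 1 - \<delta> \<longrightarrow>
        (\<exists>u\<^sub>0\<in>norm_attainment_set A. norm (u\<^sub>0 - x\<^sub>0) < \<epsilon>))"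

definition nontrivial_uniform_BPB_approx ::
    "real \<Rightarrow> ('a::real_normed_vector \<Rightarrow>\<^sub>L 'b::real_normed_vector) \<Rightarrow> ('a \<Rightarrow>\<^sub>L 'b) \<Rightarrow> bool" where
  "nontrivial_uniform_BPB_approx \<epsilon> T A \<longleftrightarrow> uniform_BPB_approx \<epsilon> T A \<and> A \<noteq> T"

end

(* A norm-attaining smooth operator A attains its norm only at some pair u, -u: otherwise evaluation
   at two independent points of M_A gives two support functionals of A.  Hence the uniform
   BPB approximations force every maximizing sequence of T to converge, up to signs, to one point x0
   of M_T.  Since a space is smooth at z exactly when the one-sided directional derivative of the
   norm at z is linear, estimating the norm of B + n T at almost maximizing points shows that every
   support functional of T is dominated by B |-> g (B x0), where g supports T x0. *)
theory Submission
  imports Defs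
begin

section \<open>Sublinear functionals and the Hahn-Banach theorem\<close>

definition sublinear :: "('a::real_vector \<Rightarrow> real) \<Rightarrow> bool" where
  "sublinear p \<longleftrightarrow>
     (\<forall>x y. p (x + y) \<le> p x + p y) \<and> (\<forall>c x. c \<ge> 0 \<longrightarrow> p (c *\<^sub>R x) = c * p x)"

text \<open>Applying the homogeneity inequality to \<open>inverse c\<close> and
  \<open>c *\<^sub>R x\<close> yields its converse, so one direction suffices.\<close>

lemma sublinearI:
  assumes "\<And>x y. p (x + y) \<le> p x + p y" "\<And>c x. c > 0 \<Longrightarrow> p (c *\<^sub>R x) \<le> c * p x" "p 0 = 0"
  shows "sublinear p"
proof -
  have "p (c *\<^sub>R x) = c * p x" if "c \<ge> 0" for c x
  proof (cases "c = 0")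
    case True
    with assms(3) show ?thesis by simp
  next
    case False
    with that have c: "c > 0" by simp
    have "p x \<le> inverse c * p (c *\<^sub>R x)"
      using assms(2)[of "inverse c" "c *\<^sub>R x"] c by simp
    then have "c * p x \<le> p (c *\<^sub>R x)"
      using c by (simp add: field_simps)
    with assms(2)[OF c, of x] show ?thesis by simp
  qed
  with assms(1) show ?thesis unfolding sublinear_def by blast
qed

lemma sublinear_add: "sublinear p \<Longrightarrow> p (x + y) \<le> p x + p y"
  by (simp add: sublinear_def)

lemma sublinear_scaleR: "sublinear p \<Longrightarrow> c \<ge> 0 \<Longrightarrow> p (c *\<^sub>R x) = c * p x"
  by (simp add: sublinear_def)

lemma sublinear_zero: "sublinear p \<Longrightarrow> p 0 = 0"
  using sublinear_scaleR[of p 0 0] by simp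

lemma sublinear_ge_neg: "sublinear p \<Longrightarrow> - p (- x) \<le> p x"
  using sublinear_add[of p x "- x"] sublinear_zero[of p] by simp

lemma sublinear_norm: "sublinear norm"
  by (simp add: sublinear_def norm_triangle_ineq)

text \<open>For \<open>p = norm\<close> the substitution \<open>s = 1 / t\<close> shows that this is the right derivative of the
  norm at \<open>z\<close> in direction \<open>x\<close>, that is, the infimum of \<open>(norm (z + s x) - norm z) / s\<close>
  over \<open>s > 0\<close>.\<close>

definition directional :: "('a::real_vector \<Rightarrow> real) \<Rightarrow> 'a \<Rightarrow> 'a \<Rightarrow> real" where
  "directional p z x = (INF t\<in>{0..}. p (x + t *\<^sub>R z) - t * p z)"

lemma directional_bdd_below:
  assumes "sublinear p"
  shows "bdd_below ((\<lambda>t. p (x + t *\<^sub>R z) - t * p z) ` {0..})"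
proof (rule bdd_belowI2)
  fix t :: real assume "t \<in> {0..}"
  then have "t * p z = p (t *\<^sub>R z)"
    using sublinear_scaleR[OF assms, of t z] by simp
  also have "\<dots> \<le> p (x + t *\<^sub>R z) + p (- x)"
    using sublinear_add[OF assms, of "x + t *\<^sub>R z" "- x"] by simp
  finally show "- p (- x) \<le> p (x + t *\<^sub>R z) - t * p z" by simp
qed

lemma directional_le:
  assumes "sublinear p" "t \<ge> 0"
  shows "directional p z x \<le> p (x + t *\<^sub>R z) - t * p z"
  unfolding directional_def
  by (rule cINF_lower[OF directional_bdd_below[OF assms(1)]]) (use assms in simp)

lemma directional_le_self: "sublinear p \<Longrightarrow> directional p z x \<le> p x"
  using directional_le[of p 0 z x] by simp

text \<open>A linear functional below \<open>directional p z\<close> thus has value at least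
  \<open>p z\<close> at \<open>z\<close>; this is what turns domination into support at
  \<open>z\<close>.\<close>

lemma directional_neg_le: "sublinear p \<Longrightarrow> directional p z (- z) \<le> - p z"
  using directional_le[of p 1 z "- z"] sublinear_zero[of p] by simp

lemma directional_less:
  assumes "e > 0"
  obtains t where "t \<ge> 0" "p (x + t *\<^sub>R z) - t * p z < directional p z x + e"
proof -
  have "\<exists>t\<in>{0..}. p (x + t *\<^sub>R z) - t * p z < directional p z x + e"
  proof (rule ccontr)
    assume "\<not> ?thesis"
    then have "directional p z x + e \<le> directional p z x"
      unfolding directional_def[of p z x]
      by (intro cINF_greatest) (auto simp: not_less directional_def[symmetric])
    with assms show False by simp
  qed
  with that show ?thesis by auto
qed

text \<open>If \<open>s\<close> and \<open>t\<close> are nearly optimal parameters for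
  \<open>x\<close> and \<open>y\<close>, then \<open>s + t\<close> is admissible for
  \<open>x + y\<close>, and \<open>c * t\<close> for \<open>c *\<^sub>R x\<close>.\<close>

lemma sublinear_directional:
  assumes p: "sublinear p"
  shows "sublinear (directional p z)"
proof (rule sublinearI)
  fix x y
  show "directional p z (x + y) \<le> directional p z x + directional p z y"
  proof (rule field_le_epsilon)
    fix e :: real assume "e > 0"
    then have e: "e / 2 > 0" by simp
    obtain s where s: "s \<ge> 0" "p (x + s *\<^sub>R z) - s * p z < directional p z x + e / 2"
      using directional_less[OF e] .
    obtain t where t: "t \<ge> 0" "p (y + t *\<^sub>R z) - t * p z < directional p z y + e / 2"
      using directional_less[OF e] .
    have "directional p z (x + y) \<le> p ((x + s *\<^sub>R z) + (y + t *\<^sub>R z)) - (s + t) * p z"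
      using directional_le[OF p, of "s + t" z "x + y"] s t by (simp add: algebra_simps)
    also have "\<dots> \<le> p (x + s *\<^sub>R z) + p (y + t *\<^sub>R z) - (s + t) * p z"
      using sublinear_add[OF p] by simp
    finally show "directional p z (x + y) \<le> directional p z x + directional p z y + e"
      using s(2) t(2) by (simp add: algebra_simps)
  qed
next
  fix c :: real and x assume c: "c > 0"
  show "directional p z (c *\<^sub>R x) \<le> c * directional p z x"
  proof (rule field_le_epsilon)
    fix e :: real assume "e > 0"
    then have e: "e / c > 0" using c by simp
    obtain t where t: "t \<ge> 0" "p (x + t *\<^sub>R z) - t * p z < directional p z x + e / c"
      using directional_less[OF e] .
    have "directional p z (c *\<^sub>R x) \<le> p (c *\<^sub>R (x + t *\<^sub>R z)) - (c * t) * p z"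
      using directional_le[OF p, of "c * t" z "c *\<^sub>R x"] c t by (simp add: algebra_simps)
    also have "\<dots> = c * (p (x + t *\<^sub>R z) - t * p z)"
      using sublinear_scaleR[OF p, of c "x + t *\<^sub>R z"] c by (simp add: right_diff_distrib)
    also have "\<dots> \<le> c * (directional p z x + e / c)"
      using t c by (intro mult_left_mono) auto
    finally show "directional p z (c *\<^sub>R x) \<le> c * directional p z x + e"
      using c by (simp add: algebra_simps)
  qed
next
  have "p (0 + t *\<^sub>R z) - t * p z = 0" if "t \<in> {0..}" for t
    using that sublinear_scaleR[OF p, of t z] by simp
  then show "directional p z 0 = 0"
    unfolding directional_def by (simp cong: INF_cong_simp)
qed

text \<open>A minimal sublinear functional \<open>q\<close> is linear, since it coincides with \<open>directional q y\<close>
  for every \<open>y\<close>.\<close>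

lemma ex_linear_le_sublinear:
  assumes p: "sublinear p"
  obtains f where "linear f" "\<And>x. f x \<le> p x"
proof -
  define A where "A = {q. sublinear q \<and> (\<forall>x. q x \<le> p x)}"
  \<comment> \<open>The pointwise order is reversed, so that the maximal element from Zorn's lemma
    is a minimal functional and a chain is bounded by its pointwise infimum.\<close>
  let ?P = "\<lambda>q r::'a \<Rightarrow> real. \<forall>x. r x \<le> q x"
  have "\<exists>m\<in>A. \<forall>q\<in>A. ?P m q \<longrightarrow> q = m"
  proof (rule predicate_Zorn)
    show "partial_order_on A (relation_of ?P A)"
      proof (rule partial_order_on_relation_ofI)
      show "?P q s" if "?P q r" "?P r s" for q r s :: "'a \<Rightarrow> real"
        using that order_trans by blast
      show "q = r" if "?P q r" "?P r q" for q r :: "'a \<Rightarrow> real"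
        using that by (intro ext antisym) auto
    qed simp
  next
    fix C assume "C \<in> Chains (relation_of ?P A)"
    then have CA: "C \<subseteq> A" and tot: "\<And>q r. q \<in> C \<Longrightarrow> r \<in> C \<Longrightarrow> ?P q r \<or> ?P r q"
      unfolding Chains_def relation_of_def by blast+
    show "\<exists>u\<in>A. \<forall>a\<in>C. ?P a u"
    proof (cases "C = {}")
      case True
      with p show ?thesis unfolding A_def by blast
    next
      case False
      define u where "u x = (INF q\<in>C. q x)" for x
      have sub: "sublinear q" and le: "q x \<le> p x" if "q \<in> C" for q x
        using CA that by (auto simp: A_def)
      have bdd: "bdd_below ((\<lambda>q. q x) ` C)" for x
      proof (rule bdd_belowI2)
        fix q assume "q \<in> C"
        then show "- p (- x) \<le> q x"
          using sublinear_ge_neg[of q x] sub[of q] le[of q "- x"] by simp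
      qed
      have u_le: "u x \<le> q x" if "q \<in> C" for q x
        unfolding u_def by (rule cINF_lower[OF bdd that])
      have u_less: "\<exists>q\<in>C. q x < u x + e" if "e > 0" for x e
      proof (rule ccontr)
        assume "\<not> ?thesis"
        then have "u x + e \<le> u x"
          unfolding u_def[of x] using False
          by (intro cINF_greatest) (auto simp: not_less u_def[symmetric])
        with that show False by simp
      qed
      have "sublinear u"
      proof (rule sublinearI)
        fix x y
        show "u (x + y) \<le> u x + u y"
        proof (rule field_le_epsilon)
          fix e :: real assume "e > 0"
          then have e: "e / 2 > 0" by simp
          from u_less[OF e] obtain q where q: "q \<in> C" "q x < u x + e / 2" by blast
          from u_less[OF e] obtain r where r: "r \<in> C" "r y < u y + e / 2" by blast
          \<comment> \<open>Since \<open>C\<close> is a chain, the smaller of \<open>q\<close> and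
            \<open>r\<close> serves both points at once.\<close>
          obtain s where s: "s \<in> C" "s x \<le> q x" "s y \<le> r y"
            using tot[OF q(1) r(1)] q(1) r(1) by blast
          show "u (x + y) \<le> u x + u y + e"
            using u_le[OF s(1), of "x + y"] sublinear_add[OF sub[OF s(1)], of x y] s q r by simp
        qed
      next
        fix c :: real and x assume c: "c > 0"
        show "u (c *\<^sub>R x) \<le> c * u x"
        proof (rule field_le_epsilon)
          fix e :: real assume "e > 0"
          then have "e / c > 0" using c by simp
          from u_less[OF this] obtain q where q: "q \<in> C" "q x < u x + e / c" by blast
          have "u (c *\<^sub>R x) \<le> c * q x"
            using u_le[OF q(1), of "c *\<^sub>R x"] sublinear_scaleR[OF sub[OF q(1)], of c x] c by simp
          also have "\<dots> \<le> c * (u x + e / c)"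
            using q c by (intro mult_left_mono) auto
          finally show "u (c *\<^sub>R x) \<le> c * u x + e"
            using c by (simp add: algebra_simps)
        qed
      next
        have "q 0 = 0" if "q \<in> C" for q
          using sublinear_zero[OF sub[OF that]] .
        then have "(\<lambda>q. q 0) ` C = {0}" using False by force
        then show "u 0 = 0" unfolding u_def by simp
      qed
      moreover have "u x \<le> p x" for x
        using False u_le le by (meson all_not_in_conv order_trans)
      ultimately show ?thesis
        using u_le unfolding A_def by blast
    qed
  qed
  then obtain m where "m \<in> A" and max: "\<And>q. q \<in> A \<Longrightarrow> ?P m q \<Longrightarrow> q = m"
    by blast
  then have m: "sublinear m" "\<And>x. m x \<le> p x"
    by (auto simp: A_def)
  have min: "q = m" if "sublinear q" "\<And>x. q x \<le> m x" for q
    using max[of q] that order_trans[OF that(2) m(2)] by (simp add: A_def)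
  have dir: "directional m y = m" for y
    by (rule min[OF sublinear_directional[OF m(1)] directional_le_self[OF m(1)]])
  \<comment> \<open>As \<open>directional m y = m\<close>, the parameter 1 gives
    \<open>m x \<le> m (x + y) - m y\<close>, which is superadditivity.\<close>
  have add: "m (x + y) = m x + m y" for x y
    using directional_le[OF m(1), of 1 y x] sublinear_add[OF m(1), of x y] by (simp add: dir)
  have neg: "m (- x) = - m x" for x
    using add[of x "- x"] sublinear_zero[OF m(1)] by simp
  have "m (c *\<^sub>R x) = c *\<^sub>R m x" for c x
  proof (cases "c \<ge> 0")
    case True
    with sublinear_scaleR[OF m(1)] show ?thesis by simp
  next
    case False
    then have "m (- (c *\<^sub>R x)) = - c * m x"
      using sublinear_scaleR[OF m(1), of "- c" x] by simp
    with neg[of "c *\<^sub>R x"] show ?thesis by simp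
  qed
  with add have "linear m" by (intro linearI)
  with m(2) that show ?thesis by blast
qed

text \<open>A linear functional below \<open>directional p z\<close> lies below \<open>p\<close>,
  and its value at \<open>- z\<close> forces equality with \<open>p\<close> at
  \<open>z\<close>.\<close>

theorem hahn_banach_sublinear:
  assumes p: "sublinear p"
  obtains f where "linear f" "\<And>x. f x \<le> p x" "f z = p z"
proof -
  obtain f where f: "linear f" "\<And>x. f x \<le> directional p z x"
    using ex_linear_le_sublinear[OF sublinear_directional[OF p, of z]] by blast
  have le: "f x \<le> p x" for x
    using f(2)[of x] directional_le_self[OF p, of z x] by simp
  have "- f z \<le> - p z"
    using f(2)[of "- z"] directional_neg_le[OF p, of z] linear_neg[OF f(1), of z] by simp
  with le[of z] have "f z = p z" by simp
  with f(1) le that show ?thesis by blast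
qed

section \<open>Support functionals\<close>

lemma linear_le_norm_blinfun:
  fixes f :: "'a::real_normed_vector \<Rightarrow> real"
  assumes "linear f" "\<And>x. f x \<le> norm x"
  obtains F :: "'a \<Rightarrow>\<^sub>L real" where "blinfun_apply F = f" "norm F \<le> 1"
proof -
  have abs: "norm (f x) \<le> norm x" for x
    using assms(2)[of x] assms(2)[of "- x"] linear_neg[OF assms(1), of x] by simp
  have "bounded_linear f"
    using assms(1) abs by (auto simp: linear_linear intro!: bounded_linear_intro[where K = 1]
        simp: linear_add linear_cmul)
  then have app: "blinfun_apply (Blinfun f) = f"
    by (rule bounded_linear_Blinfun_apply)
  then have "norm (Blinfun f) \<le> 1"
    using abs by (intro norm_blinfun_bound) auto
  with app that show ?thesis by blast
qed

lemma norm_eq_one_if_attains: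
  fixes F :: "'a::real_normed_vector \<Rightarrow>\<^sub>L real"
  assumes "norm F \<le> 1" "z \<noteq> 0" "F z = norm z"
  shows "norm F = 1"
proof -
  have "1 * norm z \<le> norm F * norm z"
    using norm_blinfun[of F z] assms(3) by simp
  then have "1 \<le> norm F"
    using assms(2) by (simp only: mult_le_cancel_right) simp
  with assms(1) show ?thesis by simp
qed

lemma ex_support_functional:
  fixes z :: "'a::real_normed_vector"
  assumes "z \<noteq> 0"
  obtains F :: "'a \<Rightarrow>\<^sub>L real" where "norm F = 1" "F z = norm z"
proof -
  obtain f :: "'a \<Rightarrow> real" where f: "linear f" "\<And>x. f x \<le> norm x" "f z = norm z"
    using hahn_banach_sublinear[OF sublinear_norm, of z] by blast
  obtain F :: "'a \<Rightarrow>\<^sub>L real" where F: "blinfun_apply F = f" "norm F \<le> 1"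
    using linear_le_norm_blinfun[OF f(1,2)] .
  with f(3) assms that norm_eq_one_if_attains[of F z] show ?thesis by simp
qed

lemma smooth_element_unique:
  fixes F G :: "'a::real_normed_vector \<Rightarrow>\<^sub>L real"
  assumes "smooth_element z" "norm F = 1" "F z = norm z" "norm G = 1" "G z = norm z"
  shows "F = G"
  using assms unfolding smooth_element_def by auto

text \<open>Hahn-Banach gives a linear functional below \<open>directional norm z\<close> that
  agrees with it at \<open>v\<close>. It supports \<open>z\<close>, so by uniqueness it is
  \<open>G\<close>.\<close>

lemma smooth_element_directional:
  fixes z :: "'a::real_normed_vector"
  assumes z: "smooth_element z" and G: "norm G = 1" "blinfun_apply G z = norm z"
  shows "directional norm z v = G v"
proof -
  obtain f :: "'a \<Rightarrow> real" where f: "linear f" "\<And>x. f x \<le> directional norm z x"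
      "f v = directional norm z v"
    using hahn_banach_sublinear[OF sublinear_directional[OF sublinear_norm, of z], of v] by blast
  have le: "f x \<le> norm x" for x
    using f(2)[of x] directional_le_self[OF sublinear_norm, of z x] by simp
  obtain F :: "'a \<Rightarrow>\<^sub>L real" where F: "blinfun_apply F = f" "norm F \<le> 1"
    using linear_le_norm_blinfun[OF f(1) le] .
  have "- f z \<le> - norm z"
    using f(2)[of "- z"] directional_neg_le[OF sublinear_norm, of z] linear_neg[OF f(1), of z]
    by simp
  with le[of z] have Fz: "F z = norm z" by (simp add: F)
  have "z \<noteq> 0" using z by (simp add: smooth_element_def)
  then have "norm F = 1" using norm_eq_one_if_attains F(2) Fz by blast
  then have "F = G" using smooth_element_unique[OF z _ Fz G] by blast
  with F f(3) show ?thesis by simp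
qed

section \<open>Norm attainment of smooth operators\<close>

text \<open>Evaluation at \<open>x\<close> followed by \<open>g\<close> has norm at most 1, because
  \<open>x\<close> and \<open>g\<close> are unit vectors, and it takes the value
  \<open>norm A\<close> at \<open>A\<close>.\<close>

lemma eval_support_functional:
  fixes A :: "'a::real_normed_vector \<Rightarrow>\<^sub>L 'b::real_normed_vector" and g :: "'b \<Rightarrow>\<^sub>L real"
  assumes "A \<noteq> 0" "norm x = 1" "norm (A x) = norm A" "norm g = 1" "g (A x) = norm (A x)"
  shows "\<exists>F :: ('a \<Rightarrow>\<^sub>L 'b) \<Rightarrow>\<^sub>L real.
    norm F = 1 \<and> blinfun_apply F A = norm A \<and>
      (\<forall>B. blinfun_apply F B = g (blinfun_apply B x))"
proof -
  have "bounded_linear (\<lambda>B. blinfun_apply g (blinfun_apply B x))"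
    by (intro bounded_linear_intros)
  then have app: "Blinfun (\<lambda>B. g (blinfun_apply B x)) B = g (blinfun_apply B x)" for B
    by (simp add: bounded_linear_Blinfun_apply)
  have "norm (g (blinfun_apply B x)) \<le> norm B" for B
    using norm_blinfun[of g "B x"] norm_blinfun[of B x] assms(2,4) by simp
  then have le: "norm (Blinfun (\<lambda>B. g (blinfun_apply B x))) \<le> 1"
    by (intro norm_blinfun_bound) (auto simp: app)
  have att: "Blinfun (\<lambda>B. g (blinfun_apply B x)) A = norm A"
    using app assms(3,5) by simp
  show ?thesis
    using norm_eq_one_if_attains[OF le assms(1) att] att app by blast
qed

text \<open>The support functionals of \<open>A\<close> built from \<open>u\<close> and from
  \<open>v\<close> coincide. Testing them on rank one operators makes \<open>u\<close> a multiple of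
  \<open>v\<close>, and both have norm 1.\<close>

lemma smooth_operator_attainment:
  fixes A :: "'a::real_normed_vector \<Rightarrow>\<^sub>L 'b::real_normed_vector"
  assumes A: "smooth_element A" and u: "u \<in> norm_attainment_set A" and v: "v \<in> norm_attainment_set A"
  shows "v = u \<or> v = - u"
proof -
  have A0: "A \<noteq> 0" using A by (simp add: smooth_element_def)
  have u': "norm u = 1" "norm (A u) = norm A" and v': "norm v = 1" "norm (A v) = norm A"
    using u v by (auto simp: norm_attainment_set_def)
  have "A u \<noteq> 0" "A v \<noteq> 0" using A0 u' v' by auto
  obtain g :: "'b \<Rightarrow>\<^sub>L real" where g: "norm g = 1" "g (A u) = norm (A u)"
    using ex_support_functional[OF \<open>A u \<noteq> 0\<close>] .
  obtain h :: "'b \<Rightarrow>\<^sub>L real" where h: "norm h = 1" "h (A v) = norm (A v)"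
    using ex_support_functional[OF \<open>A v \<noteq> 0\<close>] .
  obtain F :: "('a \<Rightarrow>\<^sub>L 'b) \<Rightarrow>\<^sub>L real"
    where F: "norm F = 1" "F A = norm A" "\<And>B. F B = g (blinfun_apply B u)"
    using eval_support_functional[OF A0 u' g] by blast
  obtain H :: "('a \<Rightarrow>\<^sub>L 'b) \<Rightarrow>\<^sub>L real"
    where H: "norm H = 1" "H A = norm A" "\<And>B. H B = h (blinfun_apply B v)"
    using eval_support_functional[OF A0 v' h] by blast
  have FH: "F = H" by (rule smooth_element_unique[OF A F(1,2) H(1,2)])
  define c where "c = h (A u) / norm A"
  have "\<phi> u = c * \<phi> v" for \<phi> :: "'a \<Rightarrow>\<^sub>L real"
  proof -
    \<comment> \<open>Compare the two functionals on the rank one operator with range spanned by \<open>A u\<close>.\<close>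
    have "bounded_linear (\<lambda>x. \<phi> x *\<^sub>R A u)"
      by (intro bounded_linear_intros)
    then have "g (\<phi> u *\<^sub>R A u) = h (\<phi> v *\<^sub>R A u)"
      using F(3)[of "Blinfun (\<lambda>x. \<phi> x *\<^sub>R A u)"] H(3)[of "Blinfun (\<lambda>x. \<phi> x *\<^sub>R A u)"] FH
      by (simp add: bounded_linear_Blinfun_apply)
    then show ?thesis
      using g(2) u'(2) A0 by (simp add: c_def blinfun.scaleR_right field_simps)
  qed
  then have zero: "\<phi> (u - c *\<^sub>R v) = 0" for \<phi> :: "'a \<Rightarrow>\<^sub>L real"
    by (simp add: blinfun.diff_right blinfun.scaleR_right)
  have "u = c *\<^sub>R v"
  proof (rule ccontr)
    assume "u \<noteq> c *\<^sub>R v"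
    then have ne: "u - c *\<^sub>R v \<noteq> 0" by simp
    \<comment> \<open>The dual separates points: a support functional of the difference cannot
      vanish on it.\<close>
    obtain \<phi> :: "'a \<Rightarrow>\<^sub>L real" where "\<phi> (u - c *\<^sub>R v) = norm (u - c *\<^sub>R v)"
      using ex_support_functional[OF ne] by blast
    with zero ne show False by simp
  qed
  then have "c = 1 \<or> c = - 1" using u'(1) v'(1) by auto
  with \<open>u = c *\<^sub>R v\<close> show ?thesis by auto
qed

section \<open>Strong norm attainment implies smoothness\<close>

text \<open>The unit vector \<open>x0\<close> excludes the zero space; in the argument by
  contradiction it makes the bound \<open>norm S - e\<close> non-negative.\<close>

lemma blinfun_almost_attained:
  fixes S :: "'a::real_normed_vector \<Rightarrow>\<^sub>L 'b::real_normed_vector"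
  assumes e: "e > 0" and ne: "norm (x0 :: 'a) = 1"
  obtains x where "norm x = 1" "norm (S x) > norm S - e"
proof (rule ccontr)
  assume "\<not> thesis"
  with that have le: "norm (S x) \<le> norm S - e" if "norm x = 1" for x
    using \<open>norm x = 1\<close> by (meson not_le)
  have "norm (S x) \<le> (norm S - e) * norm x" for x
  proof (cases "x = 0")
    case False
    then have "norm (S (x /\<^sub>R norm x)) \<le> norm S - e" by (intro le) simp
    with False show ?thesis by (simp add: blinfun.scaleR_right field_simps)
  qed simp
  moreover have "0 \<le> norm S - e" using le[OF ne] norm_ge_zero order_trans by blast
  ultimately have "norm S \<le> norm S - e" by (intro norm_blinfun_bound)
  with e show False by simp
qed

text \<open>A support functional \<open>F\<close> of \<open>T\<close> satisfies
  \<open>F B + n \<le> norm (B + n *\<^sub>R T)\<close>. For large \<open>n\<close>, near maximizers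
  of \<open>B + n *\<^sub>R T\<close> also nearly maximize \<open>T\<close>, so they lie near
  \<open>x0\<close> or \<open>- x0\<close>.\<close>

lemma smooth_operator_if_strongly_attained:
  fixes T :: "'a::real_normed_vector \<Rightarrow>\<^sub>L 'b::real_normed_vector"
  assumes T: "norm T = 1" and x0: "x0 \<in> norm_attainment_set T"
    and Tx0: "smooth_element (T x0)"
    and strong: "\<And>\<epsilon>. \<epsilon> > 0 \<Longrightarrow> \<exists>\<delta>>0. \<forall>x. norm x = 1 \<longrightarrow> norm (T x) > 1 - \<delta> \<longrightarrow>
                   norm (x - x0) < \<epsilon> \<or> norm (x + x0) < \<epsilon>"
  shows "smooth_element T"
proof -
  have x0': "norm x0 = 1" "norm (T x0) = norm T"
    using x0 by (auto simp: norm_attainment_set_def)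
  have T0: "T \<noteq> 0" using T by auto
  have "T x0 \<noteq> 0" using x0' T by auto
  obtain g :: "'b \<Rightarrow>\<^sub>L real" where g: "norm g = 1" "g (T x0) = norm (T x0)"
    using ex_support_functional[OF \<open>T x0 \<noteq> 0\<close>] .
  obtain G :: "('a \<Rightarrow>\<^sub>L 'b) \<Rightarrow>\<^sub>L real"
    where G: "norm G = 1" "G T = norm T" "\<And>B. G B = g (blinfun_apply B x0)"
    using eval_support_functional[OF T0 x0' g] by blast
  have le: "F B \<le> g (blinfun_apply B x0)"
    if F: "norm F = 1" "F T = norm T" for F :: "('a \<Rightarrow>\<^sub>L 'b) \<Rightarrow>\<^sub>L real" and B
  proof (rule field_le_epsilon)
    fix \<epsilon> :: real assume "\<epsilon> > 0"
    \<comment> \<open>One third each for the choice of \<open>t\<close>, for the near maximizer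
      \<open>x\<close>, and for passing from \<open>x\<close> to \<open>x0\<close>.\<close>
    define e where "e = \<epsilon> / 3"
    have e: "e > 0" using \<open>\<epsilon> > 0\<close> by (simp add: e_def)
    \<comment> \<open>Smoothness of \<open>T x0\<close> identifies the directional derivative along
      \<open>B x0\<close> with \<open>g (B x0)\<close>; \<open>t\<close> nearly attains the infimum
      defining it.\<close>
    obtain t where t: "t \<ge> 0" "norm (B x0 + t *\<^sub>R T x0) - t < g (B x0) + e"
      using directional_less[OF e, of norm "B x0" "T x0"] smooth_element_directional[OF Tx0 g]
        x0'(2) T by auto
    \<comment> \<open>\<open>S\<close> does not involve \<open>n\<close>, so the radius taken from
      \<open>strong\<close> can be fixed before \<open>n\<close>; the remainder
      \<open>(n - t) *\<^sub>R T\<close> costs at most \<open>n - t\<close>.\<close>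
    define S where "S = B + t *\<^sub>R T"
    have "e / (norm S + 1) > 0"
      using e by (simp add: add_nonneg_pos)
    from strong[OF this] obtain \<delta> where \<delta>: "\<delta> > 0"
      "\<And>x. norm x = 1 \<Longrightarrow> norm (T x) > 1 - \<delta> \<Longrightarrow>
        norm (x - x0) < e / (norm S + 1) \<or> norm (x + x0) < e / (norm S + 1)"
      by blast
    \<comment> \<open>The first bound gives \<open>n \<ge> t\<close> and \<open>n > 0\<close>. The
      second absorbs the error \<open>e\<close> and two copies of \<open>norm B\<close>, one from
      \<open>norm (B + n *\<^sub>R T)\<close> and one from \<open>norm (B x)\<close>.\<close>
    define n where "n = max (t + 1) ((2 * norm B + e) / \<delta>)"
    have n: "n \<ge> t" "n > 0" "2 * norm B + e \<le> n * \<delta>"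
      proof -
      have "t + 1 \<le> n" by (simp add: n_def)
      with t(1) show "n \<ge> t" "n > 0" by auto
      have "(2 * norm B + e) / \<delta> \<le> n" by (simp add: n_def)
      with \<delta>(1) show "2 * norm B + e \<le> n * \<delta>" by (simp add: pos_divide_le_eq)
    qed
    obtain x where x: "norm x = 1" "norm ((B + n *\<^sub>R T) x) > norm (B + n *\<^sub>R T) - e"
      using blinfun_almost_attained[OF e x0'(1)] .
    have Bx: "norm (B x) \<le> norm B" and Tx: "norm (T x) \<le> 1"
      using norm_blinfun[of B x] norm_blinfun[of T x] x(1) T by auto
    have "n \<le> norm (B + n *\<^sub>R T) + norm B"
      using norm_triangle_ineq4[of "B + n *\<^sub>R T" B] T n(2) by simp
    moreover have "norm ((B + n *\<^sub>R T) x) \<le> norm (B x) + n * norm (T x)"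
      using norm_triangle_ineq[of "B x" "n *\<^sub>R T x"] n(2)
      by (simp add: blinfun.add_left blinfun.scaleR_left)
    ultimately have "n - n * \<delta> < n * norm (T x)"
      using x(2) Bx n(3) by linarith
    then have "n * (1 - \<delta>) < n * norm (T x)" by (simp add: algebra_simps)
    then have "1 - \<delta> < norm (T x)" using n(2) by simp
    then have near: "norm (x - x0) < e / (norm S + 1) \<or> norm (x + x0) < e / (norm S + 1)"
      using \<delta>(2) x(1) by blast
    have small: "norm (S w) \<le> e" if "norm w < e / (norm S + 1)" for w
    proof -
      have "norm (S w) \<le> norm S * norm w" by (rule norm_blinfun)
      also have "\<dots> \<le> (norm S + 1) * (e / (norm S + 1))"
        using that by (intro mult_mono) auto
      also have "\<dots> = e" using norm_ge_zero[of S] by (simp add: add_nonneg_eq_0_iff)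
      finally show ?thesis .
    qed
    have Sx: "norm (S x) \<le> norm (S x0) + e"
      using near
    proof
      assume "norm (x - x0) < e / (norm S + 1)"
      from small[OF this] show ?thesis
        using norm_triangle_ineq[of "S x0" "S (x - x0)"] by (simp add: blinfun.diff_right)
    next
      assume "norm (x + x0) < e / (norm S + 1)"
      from small[OF this] show ?thesis
        using norm_triangle_ineq4[of "S (x + x0)" "S x0"] by (simp add: blinfun.add_right)
    qed
    have "F B + n = F (B + n *\<^sub>R T)"
      using F(2) T by (simp add: blinfun.add_right blinfun.scaleR_right)
    also have "\<dots> \<le> norm (B + n *\<^sub>R T)"
      using norm_blinfun[of F "B + n *\<^sub>R T"] F(1) by simp
    also have "\<dots> \<le> norm ((B + n *\<^sub>R T) x) + e" using x(2) by simp
    also have "(B + n *\<^sub>R T) x = S x + (n - t) *\<^sub>R T x"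
      by (simp add: S_def blinfun.add_left blinfun.scaleR_left algebra_simps)
    also have "norm \<dots> \<le> norm (S x) + (n - t) * norm (T x)"
      using norm_triangle_ineq[of "S x" "(n - t) *\<^sub>R T x"] n(1) by simp
    also have "(n - t) * norm (T x) \<le> n - t"
      using mult_left_mono[OF Tx, of "n - t"] n(1) by simp
    finally have "F B \<le> norm (S x) - t + e" by simp
    also have "\<dots> \<le> norm (B x0 + t *\<^sub>R T x0) - t + 2 * e"
      using Sx by (simp add: S_def blinfun.add_left blinfun.scaleR_left)
    also have "\<dots> \<le> g (B x0) + \<epsilon>"
      using t(2) by (simp add: e_def)
    finally show "F B \<le> g (B x0) + \<epsilon>" .
  qed
  have "F = G" if F: "norm F = 1" "F T = norm T" for F :: "('a \<Rightarrow>\<^sub>L 'b) \<Rightarrow>\<^sub>L real"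
  proof (rule blinfun_eqI)
    fix B
    show "F B = G B"
      \<comment> \<open>The bound at \<open>- B\<close> is the reverse inequality.\<close>
      using le[OF F, of B] le[OF F, of "- B"] G(3)[of B]
      by (simp add: blinfun.minus_left blinfun.minus_right)
  qed
  with T0 G(1,2) show ?thesis unfolding smooth_element_def by auto
qed

section \<open>Strong norm attainment from smooth uniform BPB approximations\<close>

theorem theorem3p22:
  fixes T :: "'a::banach \<Rightarrow>\<^sub>L 'b::banach"
  assumes "smooth_space TYPE('b)"
    and "T \<in> sphere 0 1"
    and "norm_attainment_set T \<noteq> {}"
    and "\<And>\<epsilon>::real. \<epsilon> > 0 \<Longrightarrow> \<exists>A. nontrivial_uniform_BPB_approx \<epsilon> T A \<and> smooth_element A"
  shows "smooth_element T"
proof -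
  have T: "norm T = 1" using assms(2) by simp
  obtain x0 where x0: "x0 \<in> norm_attainment_set T" using assms(3) by blast
  then have x0': "norm x0 = 1" "norm (T x0) = 1" using T by (auto simp: norm_attainment_set_def)
  then have "T x0 \<noteq> 0" by auto
  then have "smooth_element (T x0)" using assms(1) by (simp add: smooth_space_def)
  with T x0 show ?thesis
  proof (rule smooth_operator_if_strongly_attained)
    fix \<epsilon> :: real assume "\<epsilon> > 0"
    then obtain A where A: "uniform_BPB_approx (\<epsilon> / 2) T A" "smooth_element A"
      using assms(4)[of "\<epsilon> / 2"] by (auto simp: nontrivial_uniform_BPB_approx_def)
    then obtain \<delta> where \<delta>: "\<delta> > 0" and approx:
      "\<And>x. norm x = 1 \<Longrightarrow> norm (T x) > 1 - \<delta> \<Longrightarrow> \<exists>u\<in>norm_attainment_set A. norm (u - x) < \<epsilon> / 2"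
      unfolding uniform_BPB_approx_def by auto
    \<comment> \<open>The point \<open>x0\<close> itself satisfies the approximation condition, so
      it is compared with the same \<open>A\<close> as \<open>x\<close> is below; hence the halves
      of \<open>\<epsilon>\<close>.\<close>
    obtain u where u: "u \<in> norm_attainment_set A" "norm (u - x0) < \<epsilon> / 2"
      using approx[of x0] x0' \<delta> by auto
    have "norm (x - x0) < \<epsilon> \<or> norm (x + x0) < \<epsilon>" if x: "norm x = 1" "norm (T x) > 1 - \<delta>" for x
    proof -
      obtain v where v: "v \<in> norm_attainment_set A" "norm (v - x) < \<epsilon> / 2"
        using approx[OF x] by blast
      from smooth_operator_attainment[OF A(2) u(1) v(1)] show ?thesis
      proof
        assume "v = u"
        then show ?thesis
          using norm_triangle_ineq4[of "u - x0" "v - x"] u(2) v(2) by simp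
      next
        assume "v = - u"
        then show ?thesis
          \<comment> \<open>Here the two errors add up to \<open>- (x + x0)\<close>, since
            \<open>u\<close> and \<open>v\<close> cancel.\<close>
          using norm_triangle_ineq[of "u - x0" "v - x"] norm_minus_cancel[of "x + x0"] u(2) v(2)
          by (simp add: norm_minus_commute)
      qed
    qed
    with \<delta> show "\<exists>\<delta>>0. \<forall>x. norm x = 1 \<longrightarrow> norm (T x) > 1 - \<delta> \<longrightarrow>
        norm (x - x0) < \<epsilon> \<or> norm (x + x0) < \<epsilon>" by blast
  qed
qed

end
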